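(* Let $A=[a_{ij}]\in\mathbb{R}^{n\times n}$, $n\ge 2$, be a bdsw matrix with $a_{n1}\ge 0$ and $a_{nn}>0$. Then the following statements are equivalent: (i) $A\in\mathbf{Q}$. (ii) $A\in\mathbf{E}$. (iii) The diagonal of $A$ is positive. (iv) The diagonal of $A$ is nonnegative and $A\in\mathbf{R}_0$. (v) $A\in\mathbf{R}^*$.
   Context: A matrix $A=[a_{ij}]\in\mathbb{R}^{n\times n}$, $n\ge 2$, is a bidiagonal southwest (bdsw) matrix if $a_{ij}=0$ unless $j=i$, or $j=i+1$, or $(i,j)=(n,1)$; the entries in these positions are arbitrary real numbers (possibly zero). For $A\in\mathbb{R}^{n\times n}$ and $q\in\mathbb{R}^n$, $\mathrm{LCP}(A,q)$ is the problem of finding $x\in\mathbb{R}^n$ with $x\ge 0$, $Ax+q\ge 0$ and $x^\top(Ax+q)=0$ (inequalities between vectors are componentwise; $d>0$ means all components of $d$ are positive). - $A\in\mathbf{Q}$ if $\mathrm{LCP}(A,q)$ has a solution for every $q\in\mathbb{R}^n$. - $A\in\mathbf{R}_0$ if $x=0$ is the only solution of $\mathrm{LCP}(A,0)$. - $A\in\mathbf{E}_0$ (respectively $A\in\mathbf{E}$) if for every $d>0$ (respectively every $d\ge 0$) in $\mathbb{R}^n$, $x=0$ is the only solution of $\mathrm{LCP}(A,d)$. - $A\in\mathbf{R}^*$ if $A\in\mathbf{R}_0$ and $A\in\mathbf{E}_0$. *)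

theory Defs
  imports Complex_Main "Jordan_Normal_Form.Matrix"
begin

text \<open>Matrix and vector indices start at 0 here, so the paper's positions (i,i), (i,i+1)
  and (n,1) become (i,i), (i,i+1) and (n-1,0) with i ranging over 0,...,n-1.\<close>

definition bdsw :: "nat \<Rightarrow> real mat set" where
  "bdsw n = {A \<in> carrier_mat n n. n \<ge> 2 \<and>
     (\<forall>i<n. \<forall>j<n. \<not> (j = i \<or> j = i + 1 \<or> (i = n - 1 \<and> j = 0)) \<longrightarrow> A $$ (i, j) = 0)}"

text \<open>The order on vectors in the library is componentwise, but its strict part only means
  \<open>v \<le> w \<and> v \<noteq> w\<close>; hence a separate predicate for vectors all of whose components are positive.\<close>

definition pos_vec :: "real vec \<Rightarrow> bool" where
  "pos_vec d \<longleftrightarrow> (\<forall>i<dim_vec d. 0 < d $ i)"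

definition LCP_solutions :: "real mat \<Rightarrow> real vec \<Rightarrow> real vec set" where
  "LCP_solutions A q = {x \<in> carrier_vec (dim_col A).
     0\<^sub>v (dim_col A) \<le> x \<and> 0\<^sub>v (dim_row A) \<le> A *\<^sub>v x + q \<and> x \<bullet> (A *\<^sub>v x + q) = 0}"

definition Q_mats :: "nat \<Rightarrow> real mat set" where
  "Q_mats n = {A \<in> carrier_mat n n. \<forall>q \<in> carrier_vec n. LCP_solutions A q \<noteq> {}}"

definition R0_mats :: "nat \<Rightarrow> real mat set" where
  "R0_mats n = {A \<in> carrier_mat n n. LCP_solutions A (0\<^sub>v n) = {0\<^sub>v n}}"

definition E0_mats :: "nat \<Rightarrow> real mat set" where
  "E0_mats n = {A \<in> carrier_mat n n.
     \<forall>d \<in> carrier_vec n. pos_vec d \<longrightarrow> LCP_solutions A d = {0\<^sub>v n}}"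

definition E_mats :: "nat \<Rightarrow> real mat set" where
  "E_mats n = {A \<in> carrier_mat n n.
     \<forall>d \<in> carrier_vec n. 0\<^sub>v n \<le> d \<longrightarrow> LCP_solutions A d = {0\<^sub>v n}}"

definition Rstar_mats :: "nat \<Rightarrow> real mat set" where
  "Rstar_mats n = R0_mats n \<inter> E0_mats n"

end

theory Submission
  imports Defs
begin

text \<open>In the 1-based indexing of the paper, row \<open>i < n\<close> of \<open>Ax\<close> involves only \<open>x\<^sub>i\<close> and \<open>x\<^sub>i\<^sub>+\<^sub>1\<close>, so a
  complementarity problem with positive diagonal is solved backwards from \<open>x\<^sub>n\<close> by
  \<open>x\<^sub>i = max 0 (- (q\<^sub>i + a\<^sub>i\<^sub>,\<^sub>i\<^sub>+\<^sub>1 x\<^sub>i\<^sub>+\<^sub>1) / a\<^sub>i\<^sub>i)\<close>. The last row closes the cycle; as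
  \<open>a\<^sub>n\<^sub>1 \<ge> 0\<close>, the resulting continuous map sends a compact interval to itself and has a fixed
  point. For \<open>q \<ge> 0\<close> the signs in the last row force \<open>x\<^sub>n = 0\<close>, and then \<open>x = 0\<close> by descent.
  Conversely, the largest index \<open>k\<close> with a nonpositive diagonal entry obstructs \<open>Q\<close> (take
  \<open>q\<^sub>k = -1\<close> and \<open>q\<^sub>i = 1\<close> otherwise), the smallest index with a zero diagonal entry obstructs \<open>R\<^sub>0\<close>
  (solve backwards from \<open>x\<^sub>k = 1\<close>), and unit vectors show that matrices in \<open>E\<close>
  (respectively \<open>E\<^sub>0\<close>) have positive (respectively nonnegative) diagonal.\<close>

section \<open>Complementarity problems in components, and sign tests by unit vectors\<close>

text \<open>A sum of nonnegative terms vanishes only termwise, so the orthogonality condition splits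
  into one complementarity condition per row.\<close>

lemma LCP_solutions_iff:
  fixes A :: "real mat"
  assumes A: "A \<in> carrier_mat n n" and q: "q \<in> carrier_vec n" and x: "x \<in> carrier_vec n"
  shows "x \<in> LCP_solutions A q \<longleftrightarrow>
    (\<forall>i<n. 0 \<le> x $ i \<and> 0 \<le> (A *\<^sub>v x) $ i + q $ i \<and> x $ i * ((A *\<^sub>v x) $ i + q $ i) = 0)"
proof -
  let ?w = "\<lambda>i. (A *\<^sub>v x) $ i + q $ i"
  have dims: "dim_row A = n" "dim_col A = n" "dim_vec q = n" "dim_vec x = n"
    using assms by auto
  have "x \<bullet> (A *\<^sub>v x + q) = (\<Sum>i=0..<n. x $ i * ?w i)"
    using dims by (simp add: scalar_prod_def)
  then have "x \<in> LCP_solutions A q \<longleftrightarrow>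
      (\<forall>i<n. 0 \<le> x $ i) \<and> (\<forall>i<n. 0 \<le> ?w i) \<and> (\<Sum>i=0..<n. x $ i * ?w i) = 0"
    using dims x by (auto simp: LCP_solutions_def less_eq_vec_def)
  moreover have "(\<Sum>i=0..<n. x $ i * ?w i) = 0 \<longleftrightarrow> (\<forall>i<n. x $ i * ?w i = 0)"
    if "\<forall>i<n. 0 \<le> x $ i" "\<forall>i<n. 0 \<le> ?w i"
    using that by (subst sum_nonneg_eq_0_iff) auto
  ultimately show ?thesis by blast
qed

lemma zero_in_LCP_solutions:
  fixes A :: "real mat"
  assumes "A \<in> carrier_mat n n" "q \<in> carrier_vec n" "0\<^sub>v n \<le> q"
  shows "0\<^sub>v n \<in> LCP_solutions A q"
  using assms by (subst LCP_solutions_iff) (auto simp: less_eq_vec_def scalar_prod_def)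

text \<open>The product of \<open>A\<close> with the unit vector is column \<open>k\<close>, so the
  slack vanishes at \<open>k\<close> and is nonnegative elsewhere. This supplies the nonzero
  solutions that exclude diagonal entries of the wrong sign.\<close>

lemma unit_vec_in_LCP_solutions:
  fixes A :: "real mat"
  assumes A: "A \<in> carrier_mat n n" and d: "d \<in> carrier_vec n" and k: "k < n"
    and "d $ k = - A $$ (k, k)" and "\<And>i. i < n \<Longrightarrow> - A $$ (i, k) \<le> d $ i"
  shows "unit_vec n k \<in> LCP_solutions A d"
proof -
  let ?e = "unit_vec n k :: real vec"
  have "0 \<le> ?e $ i \<and> 0 \<le> (A *\<^sub>v ?e) $ i + d $ i \<and> ?e $ i * ((A *\<^sub>v ?e) $ i + d $ i) = 0"
    if i: "i < n" for i
  proof -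
    have "(A *\<^sub>v ?e) $ i = A $$ (i, k)" using A k i by simp
    then show ?thesis using assms(4) assms(5)[OF i] i k by (cases "i = k") simp_all
  qed
  then show ?thesis using LCP_solutions_iff[OF A d unit_vec_carrier] by blast
qed

lemma E_mats_diag_pos:
  assumes A: "A \<in> E_mats n" and k: "k < n"
  shows "0 < A $$ (k, k)"
proof (rule ccontr)
  assume neg: "\<not> 0 < A $$ (k, k)"
  \<comment> \<open>Absolute values dominate the negated column; at \<open>k\<close> they equal it,
    the diagonal entry being nonpositive.\<close>
  define d where "d = vec n (\<lambda>i. \<bar>A $$ (i, k)\<bar>)"
  have "d \<in> carrier_vec n" "0\<^sub>v n \<le> d" by (auto simp: d_def less_eq_vec_def)
  then have "LCP_solutions A d = {0\<^sub>v n}" using A by (auto simp: E_mats_def)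
  moreover have "unit_vec n k \<in> LCP_solutions A d"
    using A k neg by (intro unit_vec_in_LCP_solutions) (auto simp: d_def E_mats_def)
  ultimately show False using k unit_vec_nonzero[of k n] by auto
qed

lemma E0_mats_diag_nonneg:
  assumes A: "A \<in> E0_mats n" and k: "k < n"
  shows "0 \<le> A $$ (k, k)"
proof (rule ccontr)
  assume neg: "\<not> 0 \<le> A $$ (k, k)"
  \<comment> \<open>The entry at \<open>k\<close> is positive by assumption; adding 1 makes the
    other entries positive too.\<close>
  define d where "d = vec n (\<lambda>i. if i = k then - A $$ (k, k) else \<bar>A $$ (i, k)\<bar> + 1)"
  have "d \<in> carrier_vec n" "pos_vec d" using neg by (auto simp: d_def pos_vec_def)
  then have "LCP_solutions A d = {0\<^sub>v n}" using A by (auto simp: E0_mats_def)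
  moreover have "unit_vec n k \<in> LCP_solutions A d"
    using A k neg by (intro unit_vec_in_LCP_solutions) (auto simp: d_def E0_mats_def)
  ultimately show False using k unit_vec_nonzero[of k n] by auto
qed

lemma E_mats_subset_Rstar_mats: "E_mats n \<subseteq> Rstar_mats n"
  by (auto simp: E_mats_def Rstar_mats_def R0_mats_def E0_mats_def pos_vec_def less_eq_vec_def
      less_imp_le)

section \<open>Row formulas, backward recursion and fixed points\<close>

lemma bdsw_mult_vec:
  assumes A: "A \<in> bdsw n" and x: "x \<in> carrier_vec n" and i: "Suc i < n"
  shows "(A *\<^sub>v x) $ i = A $$ (i, i) * x $ i + A $$ (i, Suc i) * x $ Suc i"
proof -
  have "(A *\<^sub>v x) $ i = (\<Sum>j=0..<n. A $$ (i, j) * x $ j)"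
    using A x i by (auto simp: bdsw_def scalar_prod_def)
  also have "\<dots> = (\<Sum>j\<in>{i, Suc i}. A $$ (i, j) * x $ j)"
  proof (rule sum.mono_neutral_right)
    have "i \<noteq> n - 1" using i by simp
    then show "\<forall>j\<in>{0..<n} - {i, Suc i}. A $$ (i, j) * x $ j = 0"
      using A i by (auto simp: bdsw_def)
  qed (use i in auto)
  finally show ?thesis by simp
qed

lemma bdsw_mult_vec_last:
  assumes A: "A \<in> bdsw n" and x: "x \<in> carrier_vec n"
  shows "(A *\<^sub>v x) $ (n - 1) = A $$ (n - 1, n - 1) * x $ (n - 1) + A $$ (n - 1, 0) * x $ 0"
proof -
  have n: "n \<ge> 2" using A by (simp add: bdsw_def)
  have "(A *\<^sub>v x) $ (n - 1) = (\<Sum>j=0..<n. A $$ (n - 1, j) * x $ j)"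
    using A x n by (auto simp: bdsw_def scalar_prod_def)
  also have "\<dots> = (\<Sum>j\<in>{n - 1, 0}. A $$ (n - 1, j) * x $ j)"
    using A n by (intro sum.mono_neutral_right) (auto simp: bdsw_def)
  finally show ?thesis using n by simp
qed

text \<open>Here \<open>y t i\<close> is the composition of \<open>g i\<close>, ...,
  \<open>g (m - 1)\<close> applied to \<open>t\<close>. Continuity in the starting value
  \<open>t\<close> is recorded for the fixed point argument.\<close>

lemma backward_recursion:
  fixes g :: "nat \<Rightarrow> real \<Rightarrow> real"
  assumes "\<And>i. i < m \<Longrightarrow> continuous_on UNIV (g i)"
  obtains y :: "real \<Rightarrow> nat \<Rightarrow> real" where
    "\<And>t. y t m = t" "\<And>t i. i < m \<Longrightarrow> y t i = g i (y t (Suc i))"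
    "\<And>i. i \<le> m \<Longrightarrow> continuous_on UNIV (\<lambda>t. y t i)"
  using assms
proof (induction m arbitrary: thesis)
  case 0
  show ?case by (rule 0(1)[of "\<lambda>t i. t"]) auto
next
  case (Suc m)
  obtain y where y: "\<And>t. y t m = t" "\<And>t i. i < m \<Longrightarrow> y t i = g i (y t (Suc i))"
    "\<And>i. i \<le> m \<Longrightarrow> continuous_on UNIV (\<lambda>t. y t i)"
    using Suc.IH Suc.prems(2) by (metis less_SucI)
  show ?case
  \<comment> \<open>The first backward step gives \<open>g m t\<close>, from which the recursion of
    length \<open>m\<close> continues.\<close>
  proof (rule Suc.prems(1)[of "\<lambda>t i. if i = Suc m then t else y (g m t) i"])
    fix t i assume "i < Suc m"
    then show "(if i = Suc m then t else y (g m t) i) =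
        g i (if Suc i = Suc m then t else y (g m t) (Suc i))"
      using y(1,2) by (cases "i = m") auto
  next
    fix i assume i: "i \<le> Suc m"
    show "continuous_on UNIV (\<lambda>t. if i = Suc m then t else y (g m t) i)"
    proof (cases "i = Suc m")
      case False
      have "continuous_on UNIV (\<lambda>t. y (g m t) i)"
        using continuous_on_compose2[OF y(3)[of i] Suc.prems(2)[of m]] i False by simp
      then show ?thesis using False by simp
    qed simp
  qed simp
qed

text \<open>The difference \<open>t - f t\<close> is nonpositive at \<open>a\<close> and nonnegative
  at \<open>b\<close>, so the intermediate value theorem applies.\<close>

lemma continuous_self_map_fixed_point:
  fixes f :: "real \<Rightarrow> real"
  assumes "a \<le> b" "continuous_on {a..b} f" "\<And>t. t \<in> {a..b} \<Longrightarrow> f t \<in> {a..b}"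
  obtains t where "t \<in> {a..b}" "f t = t"
proof -
  have "\<exists>t. a \<le> t \<and> t \<le> b \<and> t - f t = 0"
    using assms(1) assms(3)[of a] assms(3)[of b]
    by (intro IVT') (auto intro!: continuous_intros assms(2))
  then show thesis using that by auto
qed

text \<open>This solves the scalar complementarity problem: for \<open>r < 0\<close> the slack is
  zero, otherwise \<open>x\<close> is.\<close>

lemma complementarity_max:
  fixes a r :: real
  assumes "0 < a" "x = max 0 (- r / a)"
  shows "0 \<le> x \<and> 0 \<le> a * x + r \<and> x * (a * x + r) = 0"
  using assms by (auto simp: max_def field_simps)

section \<open>Consequences of a positive diagonal\<close>

lemma bdsw_diag_pos_imp_Q_mats:
  assumes A: "A \<in> bdsw n" and corner: "0 \<le> A $$ (n - 1, 0)"
    and pos: "\<forall>i<n. 0 < A $$ (i, i)"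
  shows "A \<in> Q_mats n"
proof -
  have car: "A \<in> carrier_mat n n" and n: "n \<ge> 2" using A by (auto simp: bdsw_def)
  have "LCP_solutions A q \<noteq> {}" if q: "q \<in> carrier_vec n" for q
  proof -
    define a c where "a = A $$ (n - 1, n - 1)" and "c = A $$ (n - 1, 0)"
    define p where "p = q $ (n - 1)"
    have a: "0 < a" and c: "0 \<le> c" using pos n corner by (auto simp: a_def c_def)
    define g where "g i t = max 0 (- (A $$ (i, Suc i) * t + q $ i) / A $$ (i, i))" for i t
    have "continuous_on UNIV (g i)" if "i < n - 1" for i
    proof -
      have "i < n" using that by simp
      then have "A $$ (i, i) \<noteq> 0" using pos by force
      then show ?thesis unfolding g_def by (intro continuous_intros) auto
    qed
    then obtain y where y: "\<And>t. y t (n - 1) = t"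
        "\<And>t i. i < n - 1 \<Longrightarrow> y t i = g i (y t (Suc i))"
        "\<And>i. i \<le> n - 1 \<Longrightarrow> continuous_on UNIV (\<lambda>t. y t i)"
      using backward_recursion[of "n - 1" g] by blast
    have y0: "0 \<le> y t 0" for t using y(2)[of 0 t] n by (simp add: g_def)
    \<comment> \<open>Starting from the guess \<open>t\<close> for the last component,
      \<open>f t\<close> is the value that the last row demands; a fixed point makes all rows
      consistent.\<close>
    define f where "f t = max 0 (- (c * y t 0 + p) / a)" for t
    have "continuous_on {0..max 0 (- p / a)} f"
      unfolding f_def using a
      by (intro continuous_intros continuous_on_subset[OF y(3)]) auto
    moreover have "f t \<in> {0..max 0 (- p / a)}" for t
    proof -
      \<comment> \<open>The corner term is nonnegative and can only lower the value, which gives an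
        upper bound independent of \<open>t\<close>.\<close>
      have "- (c * y t 0 + p) / a \<le> - p / a"
        using a c y0[of t] by (intro divide_right_mono) auto
      then show ?thesis by (auto simp: f_def)
    qed
    ultimately obtain t where t: "f t = t"
      using continuous_self_map_fixed_point[of 0 "max 0 (- p / a)" f] by auto
    define x where "x = vec n (y t)"
    have x: "x \<in> carrier_vec n" by (simp add: x_def)
    have "0 \<le> x $ i \<and> 0 \<le> (A *\<^sub>v x) $ i + q $ i \<and> x $ i * ((A *\<^sub>v x) $ i + q $ i) = 0"
      if i: "i < n" for i
    proof (cases "i = n - 1")
      case True
      have "(A *\<^sub>v x) $ i + q $ i = a * t + (c * y t 0 + p)" "x $ i = t"
        using bdsw_mult_vec_last[OF A x] n y(1) True
        by (auto simp: x_def a_def c_def p_def)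
      then show ?thesis using complementarity_max[OF a t[symmetric, unfolded f_def]] by simp
    next
      case False
      then have "Suc i < n" using i by simp
      then have "(A *\<^sub>v x) $ i + q $ i = A $$ (i, i) * y t i + (A $$ (i, Suc i) * y t (Suc i) + q $ i)"
        "x $ i = y t i"
        using bdsw_mult_vec[OF A x] by (auto simp: x_def)
      moreover have "y t i = max 0 (- (A $$ (i, Suc i) * y t (Suc i) + q $ i) / A $$ (i, i))"
        using y(2)[of i t] False i by (simp add: g_def)
      ultimately show ?thesis using complementarity_max pos i by metis
    qed
    then have "x \<in> LCP_solutions A q" using LCP_solutions_iff[OF car q x] by blast
    then show ?thesis by blast
  qed
  then show ?thesis using car by (simp add: Q_mats_def)
qed

text \<open>A positive component would make its slack positive once the off-diagonal term of its row
  is nonnegative. In the last row this holds by the corner sign; in the rows above, that term is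
  zero by induction. The case \<open>k = 0\<close> gives membership in \<open>E_mats\<close>, the
  general tail serves the obstruction to \<open>Q_mats\<close>.\<close>

lemma bdsw_solution_tail_zero:
  assumes A: "A \<in> bdsw n" and corner: "0 \<le> A $$ (n - 1, 0)"
    and q: "q \<in> carrier_vec n" and x: "x \<in> carrier_vec n" "x \<in> LCP_solutions A q"
    and pos: "\<And>i. \<lbrakk>k \<le> i; i < n\<rbrakk> \<Longrightarrow> 0 < A $$ (i, i)"
    and qnn: "\<And>i. \<lbrakk>k \<le> i; i < n\<rbrakk> \<Longrightarrow> 0 \<le> q $ i"
    and "k \<le> i" "i < n"
  shows "x $ i = 0"
proof -
  have car: "A \<in> carrier_mat n n" and n: "n \<ge> 2" using A by (auto simp: bdsw_def)
  have sol: "0 \<le> x $ i" "x $ i * ((A *\<^sub>v x) $ i + q $ i) = 0" if "i < n" for i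
    using LCP_solutions_iff[OF car q x(1)] x(2) that by auto
  have zero: "x $ i = 0"
    if i: "i < n" "k \<le> i" and w: "(A *\<^sub>v x) $ i = A $$ (i, i) * x $ i + r" "0 \<le> r" for i r
  proof (rule ccontr)
    assume "x $ i \<noteq> 0"
    then have "0 < x $ i" using sol(1) i by force
    then have "0 < A $$ (i, i) * x $ i" using pos i by simp
    then have "0 < (A *\<^sub>v x) $ i + q $ i" using w qnn[of i] i by simp
    then show False using sol(2)[of i] i \<open>x $ i \<noteq> 0\<close> by simp
  qed
  have "i \<le> n - 1" using \<open>i < n\<close> by simp
  then show ?thesis using \<open>k \<le> i\<close>
  proof (induction rule: inc_induct)
    case base
    have "0 \<le> A $$ (n - 1, 0) * x $ 0" using corner sol(1)[of 0] n by simp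
    then show ?case using zero[of "n - 1"] bdsw_mult_vec_last[OF A x(1)] base n by simp
  next
    case (step i)
    then show ?case using zero[of i 0] bdsw_mult_vec[OF A x(1), of i] by simp
  qed
qed

lemma bdsw_diag_pos_imp_E_mats:
  assumes A: "A \<in> bdsw n" and corner: "0 \<le> A $$ (n - 1, 0)"
    and pos: "\<forall>i<n. 0 < A $$ (i, i)"
  shows "A \<in> E_mats n"
proof -
  have car: "A \<in> carrier_mat n n" using A by (simp add: bdsw_def)
  have "LCP_solutions A d = {0\<^sub>v n}" if d: "d \<in> carrier_vec n" "0\<^sub>v n \<le> d" for d
  proof -
    have "x = 0\<^sub>v n" if "x \<in> LCP_solutions A d" for x
    proof -
      have x: "x \<in> carrier_vec n" using that car by (auto simp: LCP_solutions_def)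
      have "x $ i = 0" if "i < n" for i
        using bdsw_solution_tail_zero[OF A corner d(1) x \<open>x \<in> LCP_solutions A d\<close>, of 0 i]
          that pos d by (auto simp: less_eq_vec_def)
      then show ?thesis using x by (intro eq_vecI) auto
    qed
    then show ?thesis using zero_in_LCP_solutions[OF car d] by blast
  qed
  then show ?thesis using car by (simp add: E_mats_def)
qed

section \<open>Obstructions from nonpositive diagonal entries\<close>

lemma bdsw_Q_mats_imp_diag_pos:
  assumes A: "A \<in> bdsw n" and corner: "0 \<le> A $$ (n - 1, 0)"
    and last: "0 < A $$ (n - 1, n - 1)" and Q: "A \<in> Q_mats n"
  shows "\<forall>i<n. 0 < A $$ (i, i)"
proof (rule ccontr)
  define S where "S = {i. i < n \<and> A $$ (i, i) \<le> 0}"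
  assume "\<not> ?thesis"
  then obtain j where "j \<in> S" by (auto simp: S_def not_less)
  then have S: "finite S" "S \<noteq> {}" by (auto simp: S_def)
  define k where "k = Max S"
  have "k \<in> S" using S by (simp add: k_def)
  then have k: "k < n" "A $$ (k, k) \<le> 0" by (auto simp: S_def)
  have pos: "0 < A $$ (i, i)" if "Suc k \<le> i" "i < n" for i
  proof (rule ccontr)
    assume "\<not> 0 < A $$ (i, i)"
    then have "i \<in> S" using that by (simp add: S_def)
    then have "i \<le> k" using S by (simp add: k_def)
    then show False using that by simp
  qed
  have "k \<noteq> n - 1" using last k by auto
  then have k': "Suc k < n" using k by simp
  \<comment> \<open>Beyond \<open>k\<close> the diagonal and \<open>q\<close> are positive, so any
    solution vanishes there; row \<open>k\<close> is left with the slack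
    \<open>A $$ (k, k) * x $ k - 1\<close>, which is negative.\<close>
  define q where "q = vec n (\<lambda>i. if i = k then -1 else 1 :: real)"
  have q: "q \<in> carrier_vec n" by (simp add: q_def)
  then obtain x where sol: "x \<in> LCP_solutions A q" using Q by (auto simp: Q_mats_def)
  have car: "A \<in> carrier_mat n n" using A by (simp add: bdsw_def)
  then have x: "x \<in> carrier_vec n" using sol by (auto simp: LCP_solutions_def)
  have "x $ Suc k = 0"
    using bdsw_solution_tail_zero[OF A corner q x sol, of "Suc k" "Suc k"] pos k'
    by (auto simp: q_def)
  then have "(A *\<^sub>v x) $ k + q $ k = A $$ (k, k) * x $ k - 1"
    using bdsw_mult_vec[OF A x k'] k by (simp add: q_def)
  moreover have "0 \<le> x $ k" "0 \<le> (A *\<^sub>v x) $ k + q $ k"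
    using LCP_solutions_iff[OF car q x] sol k by auto
  moreover have "A $$ (k, k) * x $ k \<le> 0"
    using k \<open>0 \<le> x $ k\<close> by (simp add: mult_nonpos_nonneg)
  ultimately show False by simp
qed

lemma bdsw_R0_mats_imp_diag_pos:
  assumes A: "A \<in> bdsw n" and corner: "0 \<le> A $$ (n - 1, 0)"
    and last: "0 < A $$ (n - 1, n - 1)"
    and nonneg: "\<forall>i<n. 0 \<le> A $$ (i, i)" and R0: "A \<in> R0_mats n"
  shows "\<forall>i<n. 0 < A $$ (i, i)"
proof (rule ccontr)
  let ?P = "\<lambda>i. i < n \<and> A $$ (i, i) = 0"
  assume "\<not> ?thesis"
  then have ex: "\<exists>i. ?P i" using nonneg by (metis order_le_less)
  \<comment> \<open>Minimality keeps the diagonal before \<open>k\<close> positive, so the backward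
    recursion can divide by it.\<close>
  define k where "k = (LEAST i. ?P i)"
  have k: "k < n" "A $$ (k, k) = 0" using LeastI_ex[OF ex] by (auto simp: k_def)
  have pos: "0 < A $$ (i, i)" if "i < k" for i
  proof -
    have "i < n" using that k by simp
    moreover have "A $$ (i, i) \<noteq> 0"
      using not_less_Least[of i ?P] that \<open>i < n\<close> by (simp add: k_def)
    ultimately show ?thesis using nonneg by (metis order_le_less)
  qed
  have "k \<noteq> n - 1" using last k by auto
  then have k': "Suc k < n" using k by simp
  define g where "g i t = max 0 (- (A $$ (i, Suc i) * t) / A $$ (i, i))" for i t
  have "continuous_on UNIV (g i)" if "i < k" for i
    unfolding g_def using pos[OF that] by (intro continuous_intros) auto
  then obtain y where y: "\<And>t. y t k = t" "\<And>t i. i < k \<Longrightarrow> y t i = g i (y t (Suc i))"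
      "\<And>i. i \<le> k \<Longrightarrow> continuous_on UNIV (\<lambda>t. y t i)"
    using backward_recursion[of k g] by blast
  \<comment> \<open>The value 1 at \<open>k\<close> makes \<open>x\<close> nonzero. Row
    \<open>k\<close> still has zero slack, since its diagonal entry and the next component both
    vanish.\<close>
  define x where "x = vec n (\<lambda>i. if i \<le> k then y 1 i else 0)"
  have x: "x \<in> carrier_vec n" by (simp add: x_def)
  have xnn: "0 \<le> x $ i" if "i < n" for i
    using that y(1)[of 1] y(2)[of i 1] by (cases "i < k") (auto simp: x_def g_def)
  have car: "A \<in> carrier_mat n n" and n: "n \<ge> 2" using A by (auto simp: bdsw_def)
  have "0 \<le> (A *\<^sub>v x) $ i \<and> x $ i * (A *\<^sub>v x) $ i = 0" if i: "i < n" for i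
  proof -
    consider "i < k" | "k \<le> i" "Suc i < n" | "i = n - 1" using i by linarith
    then show ?thesis
    proof cases
      case 1
      then have "(A *\<^sub>v x) $ i = A $$ (i, i) * x $ i + A $$ (i, Suc i) * y 1 (Suc i)"
        "x $ i = max 0 (- (A $$ (i, Suc i) * y 1 (Suc i)) / A $$ (i, i))"
        using bdsw_mult_vec[OF A x, of i] y(2)[of i 1] k by (auto simp: x_def g_def)
      then show ?thesis using complementarity_max[OF pos[OF 1]] by metis
    next
      case 2
      have "x $ Suc i = 0" using 2 by (simp add: x_def)
      moreover have "A $$ (i, i) * x $ i = 0"
      proof (cases "i = k")
        case False
        then have "x $ i = 0" using 2 by (simp add: x_def)
        then show ?thesis by simp
      qed (simp add: k(2))
      ultimately have "(A *\<^sub>v x) $ i = 0" using bdsw_mult_vec[OF A x 2(2)] by simp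
      then show ?thesis by simp
    next
      case 3
      \<comment> \<open>As \<open>k\<close> lies before the last index, only the corner term
        survives here, and it is nonnegative.\<close>
      have "x $ (n - 1) = 0" using k' by (simp add: x_def)
      moreover from this have "(A *\<^sub>v x) $ (n - 1) = A $$ (n - 1, 0) * x $ 0"
        using bdsw_mult_vec_last[OF A x] by simp
      moreover have "0 \<le> A $$ (n - 1, 0) * x $ 0"
        using corner xnn[of 0] n by (intro mult_nonneg_nonneg) auto
      ultimately show ?thesis unfolding 3 by (metis mult_zero_left)
    qed
  qed
  then have "x \<in> LCP_solutions A (0\<^sub>v n)"
    using xnn by (subst LCP_solutions_iff[OF car _ x]) auto
  then have "x = 0\<^sub>v n" using R0 by (auto simp: R0_mats_def)
  moreover have "x $ k = 1" using k y(1) by (simp add: x_def)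
  ultimately show False using k by simp
qed

theorem theorem5p1:
  fixes n :: nat and A :: "real mat"
  assumes "n \<ge> 2"
    and "A \<in> bdsw n"
    and "A $$ (n - 1, 0) \<ge> 0"
    and "A $$ (n - 1, n - 1) > 0"
  shows "(A \<in> Q_mats n \<longleftrightarrow> A \<in> E_mats n) \<and>
         (A \<in> E_mats n \<longleftrightarrow> (\<forall>i<n. A $$ (i, i) > 0)) \<and>
         ((\<forall>i<n. A $$ (i, i) > 0) \<longleftrightarrow> (\<forall>i<n. A $$ (i, i) \<ge> 0) \<and> A \<in> R0_mats n) \<and>
         ((\<forall>i<n. A $$ (i, i) \<ge> 0) \<and> A \<in> R0_mats n \<longleftrightarrow> A \<in> Rstar_mats n)"
proof -
  let ?pos = "\<forall>i<n. A $$ (i, i) > 0"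
  let ?iv = "(\<forall>i<n. A $$ (i, i) \<ge> 0) \<and> A \<in> R0_mats n"
  note bd = assms(2,3)
  have Q: "A \<in> Q_mats n \<longleftrightarrow> ?pos"
    using bdsw_diag_pos_imp_Q_mats[OF bd] bdsw_Q_mats_imp_diag_pos[OF bd assms(4)] by blast
  have E: "A \<in> E_mats n \<longleftrightarrow> ?pos"
    using bdsw_diag_pos_imp_E_mats[OF bd] E_mats_diag_pos by blast
  \<comment> \<open>The remaining equivalences follow from a cycle through
    \<open>Rstar_mats\<close>, statement (iv) and the positive diagonal.\<close>
  have "A \<in> Rstar_mats n \<Longrightarrow> ?iv"
    using E0_mats_diag_nonneg by (auto simp: Rstar_mats_def)
  moreover have "?iv \<Longrightarrow> ?pos"
    using bdsw_R0_mats_imp_diag_pos[OF bd assms(4)] by blast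
  moreover have "?pos \<Longrightarrow> A \<in> Rstar_mats n"
    using E E_mats_subset_Rstar_mats by blast
  ultimately show ?thesis using Q E by blast
qed

end
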